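(* Let $G$ be a formula, $N=|G|$ (number of symbols of $G$) and let $\mathcal D$ be an $\mathbf{FRJ}(G)$-derivation. Then (i) the height of $\mathcal D$ is $O(N^2)$; (ii) if $\mathcal D$ is a derivation of $G$, the height of the Kripke model $\mathrm{Mod}(\mathcal D)$ is at most $N$.
   Context: Formulas are built from a countably infinite set $\mathcal{V}$ of propositional variables and $\bot$ using $\land,\lor,\supset$. Let $\mathcal{V}_\bot=\mathcal{V}\cup\{\bot\}$, $\mathcal{L}^{\supset}$ the set of formulas with main connective $\supset$. For a formula $G$, $\mathrm{Sl}(G)$ and $\mathrm{Sr}(G)$ are the smallest subsets of the subformulas of $G$ with: $G\in\mathrm{Sr}(G)$; $A\land B$ or $A\lor B$ in $\mathrm{Sl}(G)$ (resp. $\mathrm{Sr}(G)$) implies $A,B$ in $\mathrm{Sl}(G)$ (resp. $\mathrm{Sr}(G)$); $A\supset B\in\mathrm{Sl}(G)$ implies $B\in\mathrm{Sl}(G)$, $A\in\mathrm{Sr}(G)$; $A\supset B\in\mathrm{Sr}(G)$ implies $B\in\mathrm{Sr}(G)$, $A\in\mathrm{Sl}(G)$. $\mathrm{Cl}(\Gamma)$ is the smallest set containing $\Gamma$ such that if $X,Y\in\mathrm{Cl}(\Gamma)$ and $A$ is any formula then $X\land Y,A\lor X,X\lor A,A\supset X\in\mathrm{Cl}(\Gamma)$. $\mathbf{FRJ}(G)$: let $\bar\Gamma^{At}=\mathrm{Sl}(G)\cap\mathcal V$, $\bar\Gamma^{\supset}=\mathrm{Sl}(G)\cap\mathcal L^{\supset}$,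 $\bar\Gamma=\bar\Gamma^{At}\cup\bar\Gamma^{\supset}$. Sequents: regular $\Gamma\Rightarrow C$ ($\Gamma\subseteq\bar\Gamma$, $C\in\mathrm{Sr}(G)$), irregular $\Sigma;\Theta\rightarrow C$ ($\Sigma\cup\Theta\subseteq\bar\Gamma$, $C\in\mathrm{Sr}(G)$); $\mathrm{Lhs}$ is $\Gamma$, resp. $\Sigma\cup\Theta$; conclusions always have right formula in $\mathrm{Sr}(G)$. Rules ($F\in\mathcal V_\bot$, $k\in\{1,2\}$): axioms $\bar\Gamma^{At}\setminus\{F\}\Rightarrow F$ and $\emptyset;(\bar\Gamma^{At}\setminus\{F\})\cup\bar\Gamma^{\supset}\rightarrow F$; ($\land$) $\Gamma\Rightarrow A_k/\Gamma\Rightarrow A_1\land A_2$ and $\Sigma;\Theta\rightarrow A_k/\Sigma;\Theta\rightarrow A_1\land A_2$; ($\lor$) $\Sigma_1;\Theta_1\rightarrow C_1$, $\Sigma_2;\Theta_2\rightarrow C_2 / \Sigma_1\cup\Sigma_2;\Theta_1\cap\Theta_2\rightarrow C_1\lor C_2$ if $\Sigma_1\subseteq\Sigma_2\cup\Theta_2$, $\Sigma_2\subseteq\Sigma_1\cup\Theta_1$; ($\supset_\in$) $\Gamma\Rightarrow B/\Gamma\Rightarrow A\supset B$ if $A\in\mathrm{Cl}(\Gamma)$, and $\Sigma;\Theta\cup\Lambda\rightarrow B/\Sigma\cup\Lambda;\Theta\rightarrow A\supset B$ if $\Theta\cap\Lambda=\emptyset$, $A\in\mathrm{Cl}(\Sigma\cup\Lambda)$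 and no $\Lambda'\subsetneq\Lambda$ has $A\in\mathrm{Cl}(\Sigma\cup\Lambda')$; ($\supset_{\notin}$) $\Gamma\Rightarrow B/\emptyset;\Theta\rightarrow A\supset B$ if $\Theta\subseteq\mathrm{Cl}(\Gamma)\cap\bar\Gamma$, $A\in\mathrm{Cl}(\Gamma)\setminus\mathrm{Cl}(\Theta)$ and every $\Theta'$ with $\Theta\subsetneq\Theta'\subseteq\mathrm{Cl}(\Gamma)\cap\bar\Gamma$ has $A\in\mathrm{Cl}(\Theta')$; join rules with premises $\Sigma_j;\Theta_j\rightarrow A_j$ ($1\le j\le n$, $n\ge1$): let $\Upsilon=\{A_1,\dots,A_n\}$, $\Sigma^{At}=\bigcup_j(\Sigma_j\cap\mathcal V)$, $\Sigma^{\supset}=\bigcup_j(\Sigma_j\cap\mathcal L^{\supset})$, $\Theta^{At}=\bigcap_j(\Theta_j\cap\mathcal V)$, $\Theta^{\supset}=\{Y\supset Z\in\bigcap_j(\Theta_j\cap\mathcal L^{\supset}):Y\in\Upsilon\}$, requiring $\Sigma_i\subseteq\Sigma_j\cup\Theta_j$ ($i\ne j$) and ($Y\supset Z\in\Sigma^{\supset}\Rightarrow Y\in\Upsilon$); ($\bowtie^{At}$) conclusion $\Sigma^{At}\cup(\Theta^{At}\setminus\{F\})\cup\Sigma^{\supset}\cup\Theta^{\supset}\Rightarrow F$, $F\in\mathcal V_\bot\setminus\Sigma^{At}$, where each $Y\in\Upsilon$ has some $Y\supset Z\in\mathrm{Sl}(G)$; ($\bowtie^{\lor}$) conclusion $\Sigma^{At}\cup\Theta^{At}\cup\Sigma^{\supset}\cup\Theta^{\supset}\Rightarrow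 C_1\lor C_2$, $\{C_1,C_2\}\subseteq\Upsilon$, where each $Y\in\Upsilon$ has some $Y\supset Z\in\mathrm{Sl}(G)$ or $Y\lor Z\in\mathrm{Sr}(G)$ or $Z\lor Y\in\mathrm{Sr}(G)$. A derivation is a finite tree of sequents built by these rules with axioms at the leaves; a derivation of $G$ is a derivation of some regular sequent $\Gamma\Rightarrow G$. Write $\sigma_1\mapsto_0\sigma_2$ if some rule instance has conclusion $\sigma_2$ and $\sigma_1$ among its premises; $\mapsto$ is its transitive closure and $\mapsto_*$ its reflexive-transitive closure. The height of a sequent $\sigma$ in $\mathcal D$ is $0$ if $\sigma$ is an axiom and otherwise $1+\max$ of the heights of the sequents $\sigma'$ occurring in $\mathcal D$ with $\sigma'\mapsto\sigma$; the height of $\mathcal D$ is the height of its root. For a derivation $\mathcal D$ of $G$, a p-sequent is a regular sequent occurring in $\mathcal D$ that is an axiom or the conclusion of a join rule; $\mathrm{Mod}(\mathcal D)=(P,\le,\rho,V)$ where $P$ is the set of p-sequents of $\mathcal D$, $\sigma_1\le\sigma_2$ iff $\sigma_2\mapsto_*\sigma_1$, $\rho$ is the $\le$-minimum, and $V(\sigma)=\mathrm{Lhs}(\sigma)\cap\mathcal V$. The height of a world of a Kripke model is $0$ if it is maximal and otherwise $1+$ the maximal height of a strictly greater world; the height of the model is the height of its root. *)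

theory Defs
  imports Complex_Main "HOL-Library.Landau_Symbols"
begin

datatype form =
    Var nat
  | Falsum
  | Conj form form (infixr "\<sqdot>\<and>" 75)
  | Disj form form (infixr "\<sqdot>\<or>" 70)
  | Imp form form (infixr "\<sqdot>\<supset>" 65)

text \<open>Number of symbols: occurrences of variables, of falsum and of connectives,
  without parentheses.\<close>

fun fsize :: "form \<Rightarrow> nat" where
  "fsize (Var p) = 1"
| "fsize Falsum = 1"
| "fsize (A \<sqdot>\<and> B) = Suc (fsize A + fsize B)"
| "fsize (A \<sqdot>\<or> B) = Suc (fsize A + fsize B)"
| "fsize (A \<sqdot>\<supset> B) = Suc (fsize A + fsize B)"

definition vars :: "form set" where
  "vars = range Var"

definition vars_bot :: "form set" where
  "vars_bot = insert Falsum vars"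

definition imps :: "form set" where
  "imps = {A \<sqdot>\<supset> B | A B. True}"

inductive_set Sl :: "form \<Rightarrow> form set" and Sr :: "form \<Rightarrow> form set" for G :: form where
  "G \<in> Sr G"
| "A \<sqdot>\<and> B \<in> Sl G \<Longrightarrow> A \<in> Sl G"
| "A \<sqdot>\<and> B \<in> Sl G \<Longrightarrow> B \<in> Sl G"
| "A \<sqdot>\<or> B \<in> Sl G \<Longrightarrow> A \<in> Sl G"
| "A \<sqdot>\<or> B \<in> Sl G \<Longrightarrow> B \<in> Sl G"
| "A \<sqdot>\<and> B \<in> Sr G \<Longrightarrow> A \<in> Sr G"
| "A \<sqdot>\<and> B \<in> Sr G \<Longrightarrow> B \<in> Sr G"
| "A \<sqdot>\<or> B \<in> Sr G \<Longrightarrow> A \<in> Sr G"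
| "A \<sqdot>\<or> B \<in> Sr G \<Longrightarrow> B \<in> Sr G"
| "A \<sqdot>\<supset> B \<in> Sl G \<Longrightarrow> B \<in> Sl G"
| "A \<sqdot>\<supset> B \<in> Sl G \<Longrightarrow> A \<in> Sr G"
| "A \<sqdot>\<supset> B \<in> Sr G \<Longrightarrow> B \<in> Sr G"
| "A \<sqdot>\<supset> B \<in> Sr G \<Longrightarrow> A \<in> Sl G"

inductive_set Cl :: "form set \<Rightarrow> form set" for \<Gamma> :: "form set" where
  Cl_base: "X \<in> \<Gamma> \<Longrightarrow> X \<in> Cl \<Gamma>"
| Cl_conj: "X \<in> Cl \<Gamma> \<Longrightarrow> Y \<in> Cl \<Gamma> \<Longrightarrow> X \<sqdot>\<and> Y \<in> Cl \<Gamma>"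
| Cl_disj1: "X \<in> Cl \<Gamma> \<Longrightarrow> A \<sqdot>\<or> X \<in> Cl \<Gamma>"
| Cl_disj2: "X \<in> Cl \<Gamma> \<Longrightarrow> X \<sqdot>\<or> A \<in> Cl \<Gamma>"
| Cl_imp: "X \<in> Cl \<Gamma> \<Longrightarrow> A \<sqdot>\<supset> X \<in> Cl \<Gamma>"

definition GamAt :: "form \<Rightarrow> form set" where
  "GamAt G = Sl G \<inter> vars"

definition GamImp :: "form \<Rightarrow> form set" where
  "GamImp G = Sl G \<inter> imps"

definition Gam :: "form \<Rightarrow> form set" where
  "Gam G = GamAt G \<union> GamImp G"

text \<open>\<open>Reg \<Gamma> C\<close> is \<open>\<Gamma> \<Rightarrow> C\<close> and \<open>Irr \<Sigma> \<Theta> C\<close> is \<open>\<Sigma>; \<Theta> \<rightarrow> C\<close>.\<close>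

datatype sequent =
    Reg "form set" form
  | Irr "form set" "form set" form

fun lhs :: "sequent \<Rightarrow> form set" where
  "lhs (Reg \<Gamma> C) = \<Gamma>"
| "lhs (Irr \<Sigma> \<Theta> C) = \<Sigma> \<union> \<Theta>"

fun rhs :: "sequent \<Rightarrow> form" where
  "rhs (Reg \<Gamma> C) = C"
| "rhs (Irr \<Sigma> \<Theta> C) = C"

fun regular :: "sequent \<Rightarrow> bool" where
  "regular (Reg \<Gamma> C) = True"
| "regular (Irr \<Sigma> \<Theta> C) = False"

definition frj_sequent :: "form \<Rightarrow> sequent \<Rightarrow> bool" where
  "frj_sequent G \<sigma> \<longleftrightarrow> lhs \<sigma> \<subseteq> Gam G \<and> rhs \<sigma> \<in> Sr G"

text \<open>
  In the following schemes the lists are the premises, the last argument is the conclusion.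
  The requirement that premises and conclusion are sequents of FRJ(G) is imposed
  uniformly in \<open>frj_axiom\<close>, \<open>frj_join\<close> and \<open>frj_rule\<close>.
\<close>

inductive axiom_scheme :: "form \<Rightarrow> sequent \<Rightarrow> bool" for G :: form where
  ax_reg: "F \<in> vars_bot \<Longrightarrow> axiom_scheme G (Reg (GamAt G - {F}) F)"
| ax_irr: "F \<in> vars_bot \<Longrightarrow> axiom_scheme G (Irr {} ((GamAt G - {F}) \<union> GamImp G) F)"

inductive logical_scheme :: "form \<Rightarrow> sequent list \<Rightarrow> sequent \<Rightarrow> bool" for G :: form where
  conj_reg: "A \<in> {A1, A2} \<Longrightarrow>
    logical_scheme G [Reg \<Gamma> A] (Reg \<Gamma> (A1 \<sqdot>\<and> A2))"
| conj_irr: "A \<in> {A1, A2} \<Longrightarrow>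
    logical_scheme G [Irr \<Sigma> \<Theta> A] (Irr \<Sigma> \<Theta> (A1 \<sqdot>\<and> A2))"
| disj: "\<Sigma>1 \<subseteq> \<Sigma>2 \<union> \<Theta>2 \<Longrightarrow> \<Sigma>2 \<subseteq> \<Sigma>1 \<union> \<Theta>1 \<Longrightarrow>
    logical_scheme G [Irr \<Sigma>1 \<Theta>1 C1, Irr \<Sigma>2 \<Theta>2 C2]
      (Irr (\<Sigma>1 \<union> \<Sigma>2) (\<Theta>1 \<inter> \<Theta>2) (C1 \<sqdot>\<or> C2))"
| imp_in_reg: "A \<in> Cl \<Gamma> \<Longrightarrow>
    logical_scheme G [Reg \<Gamma> B] (Reg \<Gamma> (A \<sqdot>\<supset> B))"
| imp_in_irr: "\<Theta> \<inter> \<Lambda> = {} \<Longrightarrow> A \<in> Cl (\<Sigma> \<union> \<Lambda>) \<Longrightarrow>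
    (\<forall>\<Lambda>'. \<Lambda>' \<subset> \<Lambda> \<longrightarrow> A \<notin> Cl (\<Sigma> \<union> \<Lambda>')) \<Longrightarrow>
    logical_scheme G [Irr \<Sigma> (\<Theta> \<union> \<Lambda>) B] (Irr (\<Sigma> \<union> \<Lambda>) \<Theta> (A \<sqdot>\<supset> B))"
| imp_notin: "\<Theta> \<subseteq> Cl \<Gamma> \<inter> Gam G \<Longrightarrow> A \<in> Cl \<Gamma> - Cl \<Theta> \<Longrightarrow>
    (\<forall>\<Theta>'. \<Theta> \<subset> \<Theta>' \<and> \<Theta>' \<subseteq> Cl \<Gamma> \<inter> Gam G \<longrightarrow> A \<in> Cl \<Theta>') \<Longrightarrow>
    logical_scheme G [Reg \<Gamma> B] (Irr {} \<Theta> (A \<sqdot>\<supset> B))"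

text \<open>
  The premises of a join rule are irregular sequents, given below as triples
  \<open>(\<Sigma>\<^sub>j, \<Theta>\<^sub>j, A\<^sub>j)\<close>.
\<close>

type_synonym irr = "form set \<times> form set \<times> form"

fun irr_seq :: "irr \<Rightarrow> sequent" where
  "irr_seq (\<Sigma>, \<Theta>, A) = Irr \<Sigma> \<Theta> A"

definition Ups :: "irr list \<Rightarrow> form set" where
  "Ups ps = {A. \<exists>\<Sigma> \<Theta>. (\<Sigma>, \<Theta>, A) \<in> set ps}"

definition SigAt :: "irr list \<Rightarrow> form set" where
  "SigAt ps = (\<Union>(\<Sigma>, \<Theta>, A) \<in> set ps. \<Sigma> \<inter> vars)"

definition SigImp :: "irr list \<Rightarrow> form set" where
  "SigImp ps = (\<Union>(\<Sigma>, \<Theta>, A) \<in> set ps. \<Sigma> \<inter> imps)"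

definition ThetaAt :: "irr list \<Rightarrow> form set" where
  "ThetaAt ps = (\<Inter>(\<Sigma>, \<Theta>, A) \<in> set ps. \<Theta> \<inter> vars)"

definition ThetaImp :: "irr list \<Rightarrow> form set" where
  "ThetaImp ps =
    {Y \<sqdot>\<supset> Z | Y Z. Y \<sqdot>\<supset> Z \<in> (\<Inter>(\<Sigma>, \<Theta>, A) \<in> set ps. \<Theta> \<inter> imps) \<and> Y \<in> Ups ps}"

definition join_ok :: "irr list \<Rightarrow> bool" where
  "join_ok ps \<longleftrightarrow> ps \<noteq> []
    \<and> (\<forall>i < length ps. \<forall>j < length ps. i \<noteq> j \<longrightarrow>
         fst (ps ! i) \<subseteq> fst (ps ! j) \<union> fst (snd (ps ! j)))
    \<and> (\<forall>Y Z. Y \<sqdot>\<supset> Z \<in> SigImp ps \<longrightarrow> Y \<in> Ups ps)"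

inductive join_scheme :: "form \<Rightarrow> sequent list \<Rightarrow> sequent \<Rightarrow> bool" for G :: form where
  join_at: "join_ok ps \<Longrightarrow> F \<in> vars_bot - SigAt ps \<Longrightarrow>
    (\<forall>Y \<in> Ups ps. \<exists>Z. Y \<sqdot>\<supset> Z \<in> Sl G) \<Longrightarrow>
    join_scheme G (map irr_seq ps)
      (Reg (SigAt ps \<union> (ThetaAt ps - {F}) \<union> SigImp ps \<union> ThetaImp ps) F)"
| join_or: "join_ok ps \<Longrightarrow> {C1, C2} \<subseteq> Ups ps \<Longrightarrow>
    (\<forall>Y \<in> Ups ps. \<exists>Z. Y \<sqdot>\<supset> Z \<in> Sl G \<or> Y \<sqdot>\<or> Z \<in> Sr G \<or> Z \<sqdot>\<or> Y \<in> Sr G) \<Longrightarrow>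
    join_scheme G (map irr_seq ps)
      (Reg (SigAt ps \<union> ThetaAt ps \<union> SigImp ps \<union> ThetaImp ps) (C1 \<sqdot>\<or> C2))"

definition frj_axiom :: "form \<Rightarrow> sequent \<Rightarrow> bool" where
  "frj_axiom G \<sigma> \<longleftrightarrow> axiom_scheme G \<sigma> \<and> frj_sequent G \<sigma>"

definition frj_join :: "form \<Rightarrow> sequent list \<Rightarrow> sequent \<Rightarrow> bool" where
  "frj_join G ps \<sigma> \<longleftrightarrow> join_scheme G ps \<sigma> \<and> (\<forall>\<tau> \<in> set (\<sigma> # ps). frj_sequent G \<tau>)"

definition frj_rule :: "form \<Rightarrow> sequent list \<Rightarrow> sequent \<Rightarrow> bool" where
  "frj_rule G ps \<sigma> \<longleftrightarrow>
    (ps = [] \<and> axiom_scheme G \<sigma> \<or> logical_scheme G ps \<sigma> \<or> join_scheme G ps \<sigma>)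
    \<and> (\<forall>\<tau> \<in> set (\<sigma> # ps). frj_sequent G \<tau>)"

text \<open>\<open>seqs D\<close> is the set of sequents occurring in the tree \<open>D\<close>.\<close>

datatype (seqs: 'a) tree = Node (tree_root: 'a) "'a tree list"

inductive frj_derivation :: "form \<Rightarrow> sequent tree \<Rightarrow> bool" for G :: form where
  "frj_rule G (map tree_root Ds) \<sigma> \<Longrightarrow> (\<And>D. D \<in> set Ds \<Longrightarrow> frj_derivation G D) \<Longrightarrow>
    frj_derivation G (Node \<sigma> Ds)"

definition frj_derivation_of_goal :: "form \<Rightarrow> sequent tree \<Rightarrow> bool" where
  "frj_derivation_of_goal G D \<longleftrightarrow> frj_derivation G D \<and> (\<exists>\<Gamma>. tree_root D = Reg \<Gamma> G)"

text \<open>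
  \<open>(\<sigma>\<^sub>1, \<sigma>\<^sub>2) \<in> step G\<close> is \<open>\<sigma>\<^sub>1 \<mapsto>\<^sub>0 \<sigma>\<^sub>2\<close>.  It ranges over
  all rule instances of FRJ(G), not only those used in a given derivation.
\<close>

definition step :: "form \<Rightarrow> (sequent \<times> sequent) set" where
  "step G = {(\<sigma>1, \<sigma>2). \<exists>ps. frj_rule G ps \<sigma>2 \<and> \<sigma>1 \<in> set ps}"

lemma finite_Sl: "finite (Sl G)"
proof -
  define sub where "sub = rec_form (\<lambda>p. {Var p}) {Falsum}
    (\<lambda>A B S T. {A \<sqdot>\<and> B} \<union> S \<union> T) (\<lambda>A B S T. {A \<sqdot>\<or> B} \<union> S \<union> T)
    (\<lambda>A B S T. {A \<sqdot>\<supset> B} \<union> S \<union> T)"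
  have sub_simps: "sub (Var p) = {Var p}" "sub Falsum = {Falsum}"
    "sub (A \<sqdot>\<and> B) = {A \<sqdot>\<and> B} \<union> sub A \<union> sub B"
    "sub (A \<sqdot>\<or> B) = {A \<sqdot>\<or> B} \<union> sub A \<union> sub B"
    "sub (A \<sqdot>\<supset> B) = {A \<sqdot>\<supset> B} \<union> sub A \<union> sub B" for p A B
    by (simp_all add: sub_def)
  have fin: "finite (sub H)" for H
    by (induction H) (simp_all add: sub_simps)
  have refl: "H \<in> sub H" for H
    by (cases H) (simp_all add: sub_simps)
  have trans: "A \<in> sub B \<Longrightarrow> B \<in> sub H \<Longrightarrow> A \<in> sub H" for A B H
    by (induction H) (auto simp: sub_simps)
  have parts: "A \<in> sub (A \<sqdot>\<and> B)" "B \<in> sub (A \<sqdot>\<and> B)" "A \<in> sub (A \<sqdot>\<or> B)" "B \<in> sub (A \<sqdot>\<or> B)"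
    "A \<in> sub (A \<sqdot>\<supset> B)" "B \<in> sub (A \<sqdot>\<supset> B)" for A B
    using refl by (auto simp: sub_simps)
  have "(A \<in> Sl G \<longrightarrow> A \<in> sub G) \<and> (B \<in> Sr G \<longrightarrow> B \<in> sub G)" for A B
    by (rule Sl_Sr.induct) (blast intro: refl trans parts)+
  then show ?thesis
    using finite_subset[OF _ fin[of G]] by blast
qed

lemma finite_Gam: "finite (Gam G)"
  using finite_Sl by (simp add: Gam_def GamAt_def GamImp_def)

lemma Cl_least: "\<Gamma> \<subseteq> Cl \<Delta> \<Longrightarrow> Cl \<Gamma> \<subseteq> Cl \<Delta>"
proof
  fix X assume "\<Gamma> \<subseteq> Cl \<Delta>" and "X \<in> Cl \<Gamma>"
  from this(2,1) show "X \<in> Cl \<Delta>"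
    by induction (auto intro: Cl.intros)
qed

lemma Cl_mono: "\<Gamma> \<subseteq> \<Delta> \<Longrightarrow> Cl \<Gamma> \<subseteq> Cl \<Delta>"
  by (rule Cl_least) (auto intro: Cl_base)

lemma join_lhs:
  assumes "join_ok ps" "(\<Sigma>, \<Theta>, A) \<in> set ps"
  shows "SigAt ps \<union> ThetaAt ps \<union> SigImp ps \<union> ThetaImp ps \<subseteq> \<Sigma> \<union> \<Theta>"
proof -
  have "\<Sigma>' \<subseteq> \<Sigma> \<union> \<Theta>" if in': "(\<Sigma>', \<Theta>', A') \<in> set ps" for \<Sigma>' \<Theta>' A'
  proof -
    obtain i where i: "i < length ps" "ps ! i = (\<Sigma>', \<Theta>', A')"
      using in' by (metis in_set_conv_nth)
    obtain j where j: "j < length ps" "ps ! j = (\<Sigma>, \<Theta>, A)"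
      using assms(2) by (metis in_set_conv_nth)
    show ?thesis
    proof (cases "i = j")
      case False
      then have "fst (ps ! i) \<subseteq> fst (ps ! j) \<union> fst (snd (ps ! j))"
        using assms(1) i(1) j(1) unfolding join_ok_def by blast
      then show ?thesis using i(2) j(2) by simp
    qed (use i j in auto)
  qed
  then have "SigAt ps \<subseteq> \<Sigma> \<union> \<Theta>" "SigImp ps \<subseteq> \<Sigma> \<union> \<Theta>"
    unfolding SigAt_def SigImp_def by auto
  moreover have "ThetaAt ps \<subseteq> \<Theta>" "ThetaImp ps \<subseteq> \<Theta>"
    using assms(2) by (force simp: ThetaAt_def ThetaImp_def)+
  ultimately show ?thesis by blast
qed

lemma join_cases:
  assumes "join_scheme G ps \<sigma>" "\<tau> \<in> set ps"
  shows "regular \<sigma>" "\<not> regular \<tau>" "lhs \<sigma> \<subseteq> lhs \<tau>"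
  using assms
proof (atomize (full), induction rule: join_scheme.induct)
  case (join_at qs F)
  then obtain \<Sigma> \<Theta> A where "(\<Sigma>, \<Theta>, A) \<in> set qs" "\<tau> = Irr \<Sigma> \<Theta> A" by auto
  with join_lhs[OF join_at.hyps(1) this(1)] show ?case by auto
next
  case (join_or qs C1 C2)
  then obtain \<Sigma> \<Theta> A where "(\<Sigma>, \<Theta>, A) \<in> set qs" "\<tau> = Irr \<Sigma> \<Theta> A" by auto
  with join_lhs[OF join_or.hyps(1) this(1)] show ?case by auto
qed

lemma step_cases:
  assumes "(\<tau>, \<sigma>) \<in> step G"
  shows "lhs \<tau> \<subseteq> Gam G \<and> lhs \<sigma> \<subseteq> Cl (lhs \<tau>) \<and>
    (Cl (lhs \<sigma>) \<noteq> Cl (lhs \<tau>)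
     \<or> \<not> regular \<tau> \<and> regular \<sigma>
     \<or> regular \<tau> = regular \<sigma> \<and> fsize (rhs \<tau>) < fsize (rhs \<sigma>))"
proof -
  obtain ps where ps: "frj_rule G ps \<sigma>" "\<tau> \<in> set ps"
    using assms by (auto simp: step_def)
  then have sub: "lhs \<tau> \<subseteq> Gam G"
    by (auto simp: frj_rule_def frj_sequent_def)
  from ps consider "logical_scheme G ps \<sigma>" | "join_scheme G ps \<sigma>"
    by (auto simp: frj_rule_def)
  then show ?thesis
  proof cases
    case 1
    then have "lhs \<sigma> \<subseteq> lhs \<tau> \<or> lhs \<sigma> \<subseteq> Cl (lhs \<tau>)"
      using ps(2) by cases auto
    then have "lhs \<sigma> \<subseteq> Cl (lhs \<tau>)" by (auto intro: Cl_base)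
    from 1 this ps(2) sub show ?thesis by cases auto
  next
    case 2
    from join_cases[OF this ps(2)] sub show ?thesis by (auto intro: Cl_base)
  qed
qed

definition lhs_defect :: "form \<Rightarrow> sequent \<Rightarrow> nat" where
  "lhs_defect G \<sigma> = card (Gam G - Cl (lhs \<sigma>))"

lemma step_defect:
  assumes "(\<tau>, \<sigma>) \<in> step G"
  shows "lhs_defect G \<tau> \<le> lhs_defect G \<sigma>"
    and "Cl (lhs \<sigma>) \<noteq> Cl (lhs \<tau>) \<Longrightarrow> lhs_defect G \<tau> < lhs_defect G \<sigma>"
proof -
  have sub: "Cl (lhs \<sigma>) \<subseteq> Cl (lhs \<tau>)"
    using step_cases[OF assms] Cl_least by blast
  then show "lhs_defect G \<tau> \<le> lhs_defect G \<sigma>"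
    unfolding lhs_defect_def by (intro card_mono) (auto simp: finite_Gam)
  assume "Cl (lhs \<sigma>) \<noteq> Cl (lhs \<tau>)"
  then have "\<not> lhs \<tau> \<subseteq> Cl (lhs \<sigma>)"
    using sub Cl_least by blast
  then obtain X where "X \<in> lhs \<tau>" "X \<notin> Cl (lhs \<sigma>)" by blast
  then have "X \<in> Gam G - Cl (lhs \<sigma>)" "X \<notin> Gam G - Cl (lhs \<tau>)"
    using step_cases[OF assms] by (auto intro: Cl_base)
  with sub have "Gam G - Cl (lhs \<tau>) \<subset> Gam G - Cl (lhs \<sigma>)" by blast
  then show "lhs_defect G \<tau> < lhs_defect G \<sigma>"
    unfolding lhs_defect_def by (intro psubset_card_mono) (auto simp: finite_Gam)
qed

lemma wf_step: "wf (step G)"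
proof (rule wf_subset[OF wf_measures])
  show "step G \<subseteq> measures [lhs_defect G, \<lambda>\<sigma>. if regular \<sigma> then 1 else 0, \<lambda>\<sigma>. fsize (rhs \<sigma>)]"
  proof (rule subrelI)
    fix \<tau> \<sigma> assume "(\<tau>, \<sigma>) \<in> step G"
    from step_cases[OF this] step_defect[OF this]
    show "(\<tau>, \<sigma>) \<in> measures [lhs_defect G, \<lambda>\<sigma>. if regular \<sigma> then 1 else 0, \<lambda>\<sigma>. fsize (rhs \<sigma>)]"
      by auto
  qed
qed

lemma finite_seqs: "finite (seqs D)"
  by (induction D) auto

function seq_height :: "form \<Rightarrow> sequent tree \<Rightarrow> sequent \<Rightarrow> nat" where
  "seq_height G D \<sigma> = (if frj_axiom G \<sigma> then 0
     else 1 + Max (seq_height G D ` {\<tau> \<in> seqs D. (\<tau>, \<sigma>) \<in> (step G)\<^sup>+}))"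
  by pat_completeness auto
termination
proof (relation "same_fst (\<lambda>_. True) (\<lambda>G. same_fst (\<lambda>_. True) (\<lambda>D. (step G)\<^sup>+))")
  show "wf (same_fst (\<lambda>_. True) (\<lambda>G. same_fst (\<lambda>_ :: sequent tree. True) (\<lambda>D. (step G)\<^sup>+)))"
    by (intro wf_same_fst wf_trancl wf_step)
qed (simp add: same_fst_def)

declare seq_height.simps [simp del]

definition derivation_height :: "form \<Rightarrow> sequent tree \<Rightarrow> nat" where
  "derivation_height G D = seq_height G D (tree_root D)"

record 'w kripke =
  worlds :: "'w set"
  leq :: "('w \<times> 'w) set"
  rootw :: 'w
  val :: "'w \<Rightarrow> form set"

definition kripke_model :: "'w kripke \<Rightarrow> bool" where
  "kripke_model K \<longleftrightarrow> finite (worlds K) \<and> partial_order_on (worlds K) (leq K)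
    \<and> rootw K \<in> worlds K \<and> (\<forall>w \<in> worlds K. (rootw K, w) \<in> leq K)
    \<and> (\<forall>w \<in> worlds K. val K w \<subseteq> vars)
    \<and> (\<forall>w w'. (w, w') \<in> leq K \<longrightarrow> val K w \<subseteq> val K w')"

definition greater :: "'w kripke \<Rightarrow> 'w \<Rightarrow> 'w set" where
  "greater K w = {w' \<in> worlds K. (w, w') \<in> leq K \<and> w' \<noteq> w}"

text \<open>
  The guard only serves termination.  It holds for the models considered here, by lemma
  \<open>kripke_model_Mod\<close> below.
\<close>

function world_height :: "'w kripke \<Rightarrow> 'w \<Rightarrow> nat" where
  "world_height K w = (if kripke_model K then
       (if greater K w = {} then 0 else 1 + Max (world_height K ` greater K w))
     else undefined)"
  by pat_completeness auto
termination
proof (relation "measure (\<lambda>(K, w). card (greater K w))")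
  fix K :: "'w kripke" and w w'
  assume K: "kripke_model K" and w': "w' \<in> greater K w"
  from K have po: "antisym (leq K)" "trans (leq K)" "finite (worlds K)"
    by (auto simp: kripke_model_def partial_order_on_def preorder_on_def)
  have "greater K w' \<subset> greater K w"
    using w' po(1,2) unfolding greater_def by (auto dest: antisymD transD)
  moreover have "finite (greater K w)"
    using po(3) by (simp add: greater_def)
  ultimately show "((K, w'), (K, w)) \<in> measure (\<lambda>(K, w). card (greater K w))"
    by (simp add: psubset_card_mono)
qed auto

declare world_height.simps [simp del]

definition model_height :: "'w kripke \<Rightarrow> nat" where
  "model_height K = world_height K (rootw K)"

text \<open>
  Whether a sequent occurring in \<open>D\<close> is an axiom or the conclusion of a join rule does not
  depend on where it occurs: a regular sequent with right formula in \<open>vars_bot\<close> or with a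
  disjunction as right formula can only be obtained in this way, any other only by a logical rule.
\<close>

definition p_sequents :: "form \<Rightarrow> sequent tree \<Rightarrow> sequent set" where
  "p_sequents G D =
    {\<sigma> \<in> seqs D. regular \<sigma> \<and> (frj_axiom G \<sigma> \<or> (\<exists>ps. frj_join G ps \<sigma>))}"

definition Mod :: "form \<Rightarrow> sequent tree \<Rightarrow> sequent kripke" where
  "Mod G D = (let P = p_sequents G D; L = {(\<sigma>1, \<sigma>2) \<in> P \<times> P. (\<sigma>2, \<sigma>1) \<in> (step G)\<^sup>*} in
    \<lparr>worlds = P,
     leq = L,
     rootw = (THE \<rho>. \<rho> \<in> P \<and> (\<forall>\<sigma> \<in> P. (\<rho>, \<sigma>) \<in> L)),
     val = (\<lambda>\<sigma>. lhs \<sigma> \<inter> vars)\<rparr>)"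

lemma seqs_below_root:
  "frj_derivation G D \<Longrightarrow> \<sigma> \<in> seqs D \<Longrightarrow> (\<sigma>, tree_root D) \<in> (step G)\<^sup>*"
proof (induction rule: frj_derivation.induct)
  case (1 Ds \<rho>)
  show ?case
  proof (cases "\<sigma> = \<rho>")
    case False
    then obtain D where D: "D \<in> set Ds" "\<sigma> \<in> seqs D" using 1 by auto
    then have "(tree_root D, \<rho>) \<in> step G" using 1 by (auto simp: step_def)
    with 1 D show ?thesis by (auto intro: rtrancl_into_rtrancl)
  qed simp
qed

lemma minimum_p_sequent:
  "frj_derivation G D \<Longrightarrow> regular (tree_root D) \<Longrightarrow>
    \<exists>\<rho> \<in> p_sequents G D. \<forall>\<sigma> \<in> p_sequents G D. (\<sigma>, \<rho>) \<in> (step G)\<^sup>*"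
proof (induction rule: frj_derivation.induct)
  case (1 Ds \<rho>)
  have D: "frj_derivation G (Node \<rho> Ds)"
    using 1 by (auto intro: frj_derivation.intros)
  show ?case
  proof (cases "\<rho> \<in> p_sequents G (Node \<rho> Ds)")
    case True
    then show ?thesis
      using seqs_below_root[OF D] by (auto simp: p_sequents_def)
  next
    case False
    then have "\<not> frj_axiom G \<rho>" "\<not> frj_join G (map tree_root Ds) \<rho>"
      using 1(4) by (auto simp: p_sequents_def)
    then have "logical_scheme G (map tree_root Ds) \<rho>"
      using 1(1) unfolding frj_rule_def frj_axiom_def frj_join_def by (meson list.set_intros(1))
    then obtain D' where D': "Ds = [D']" "regular (tree_root D')"
      using 1(4) by cases auto
    then have "p_sequents G (Node \<rho> Ds) = p_sequents G D'"
      using False by (auto simp: p_sequents_def)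
    with D' 1 show ?thesis by simp
  qed
qed

lemma steps_Cl: "(\<tau>, \<sigma>) \<in> (step G)\<^sup>* \<Longrightarrow> lhs \<sigma> \<subseteq> Cl (lhs \<tau>)"
proof (induction rule: rtrancl_induct)
  case base
  then show ?case by (auto intro: Cl_base)
next
  case (step \<sigma> \<sigma>')
  then show ?case using step_cases[OF step(2)] Cl_least by blast
qed

lemma Cl_vars: "X \<in> Cl \<Gamma> \<Longrightarrow> X \<in> vars \<Longrightarrow> X \<in> \<Gamma>"
  by (induction rule: Cl.induct) (auto simp: vars_def)

lemma kripke_model_Mod:
  assumes "frj_derivation_of_goal G D"
  shows "kripke_model (Mod G D)"
proof -
  let ?P = "p_sequents G D"
  let ?L = "{(\<sigma>1, \<sigma>2) \<in> ?P \<times> ?P. (\<sigma>2, \<sigma>1) \<in> (step G)\<^sup>*}"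
  have anti: "\<sigma> = \<tau>" if "(\<sigma>, \<tau>) \<in> (step G)\<^sup>*" "(\<tau>, \<sigma>) \<in> (step G)\<^sup>*" for \<sigma> \<tau>
    using that wf_acyclic[OF wf_step[of G]]
    by (metis acyclic_def rtranclD rtrancl_trancl_trancl)
  have "partial_order_on ?P ?L"
    unfolding partial_order_on_def preorder_on_def
    by (auto simp: refl_on_def intro!: transI antisymI intro: anti rtrancl_trans)
  moreover have "finite ?P"
    using finite_seqs[of D] by (simp add: p_sequents_def)
  moreover obtain \<rho> where \<rho>: "\<rho> \<in> ?P" "\<forall>\<sigma> \<in> ?P. (\<rho>, \<sigma>) \<in> ?L"
    using minimum_p_sequent[of G D] assms by (auto simp: frj_derivation_of_goal_def)
  moreover have "(THE \<rho>. \<rho> \<in> ?P \<and> (\<forall>\<sigma> \<in> ?P. (\<rho>, \<sigma>) \<in> ?L)) = \<rho>"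
    by (rule the_equality) (use \<rho> anti in auto)
  moreover have "lhs \<sigma> \<inter> vars \<subseteq> lhs \<tau> \<inter> vars" if "(\<tau>, \<sigma>) \<in> (step G)\<^sup>*" for \<sigma> \<tau>
    using steps_Cl[OF that] Cl_vars by blast
  ultimately show ?thesis
    by (auto simp: kripke_model_def Mod_def Let_def)
qed

end

(* A step of the calculus never decreases lhs_defect, the number of formulas of Gam G outside
   Cl (lhs \<sigma>), which is at most |G|.  As long as the defect is constant, a chain of steps
   cannot pass from a regular to an irregular sequent, and within each of the two kinds the
   right formula grows, so the chain has at most 2|G| sequents.  A step into a p-sequent is a
   join, with an irregular premise; hence between two distinct comparable p-sequents, both
   regular, the defect changes, which bounds the height of the model by the defect of its root. *)

theory Submission
  imports Defs
begin

fun subformulas :: "form \<Rightarrow> form set" where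
  "subformulas (Var p) = {Var p}"
| "subformulas Falsum = {Falsum}"
| "subformulas (A \<sqdot>\<and> B) = insert (A \<sqdot>\<and> B) (subformulas A \<union> subformulas B)"
| "subformulas (A \<sqdot>\<or> B) = insert (A \<sqdot>\<or> B) (subformulas A \<union> subformulas B)"
| "subformulas (A \<sqdot>\<supset> B) = insert (A \<sqdot>\<supset> B) (subformulas A \<union> subformulas B)"

lemma finite_subformulas: "finite (subformulas G)"
  by (induction G) auto

lemma card_subformulas: "card (subformulas G) \<le> fsize G"
proof -
  have "card (insert C (S \<union> T)) \<le> Suc (m + n)" if "card S \<le> m" "card T \<le> n"
    for C :: form and S T m n
    using card_insert_le_m1[of "Suc (m + n)" "S \<union> T" C] card_Un_le[of S T] that by simp
  then show ?thesis by (induction G) auto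
qed

lemma subformulas_refl: "G \<in> subformulas G"
  by (cases G) auto

lemma subformulas_trans: "A \<in> subformulas B \<Longrightarrow> B \<in> subformulas G \<Longrightarrow> A \<in> subformulas G"
  by (induction G) auto

lemma fsize_pos: "0 < fsize A"
  by (cases A) auto

lemma fsize_subformula: "A \<in> subformulas G \<Longrightarrow> fsize A \<le> fsize G"
  by (induction G) auto

lemma Sl_Sr_subformulas: "Sl G \<subseteq> subformulas G" "Sr G \<subseteq> subformulas G"
proof -
  have parts: "A \<in> subformulas (A \<sqdot>\<and> B)" "B \<in> subformulas (A \<sqdot>\<and> B)"
    "A \<in> subformulas (A \<sqdot>\<or> B)" "B \<in> subformulas (A \<sqdot>\<or> B)"
    "A \<in> subformulas (A \<sqdot>\<supset> B)" "B \<in> subformulas (A \<sqdot>\<supset> B)" for A B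
    using subformulas_refl by auto
  have "(A \<in> Sl G \<longrightarrow> A \<in> subformulas G) \<and> (B \<in> Sr G \<longrightarrow> B \<in> subformulas G)" for A B
    by (rule Sl_Sr.induct) (blast intro: subformulas_refl subformulas_trans parts)+
  then show "Sl G \<subseteq> subformulas G" "Sr G \<subseteq> subformulas G" by blast+
qed

lemma lhs_defect_le: "lhs_defect G \<sigma> \<le> fsize G"
proof -
  have "Gam G - Cl (lhs \<sigma>) \<subseteq> subformulas G"
    using Sl_Sr_subformulas(1) by (auto simp: Gam_def GamAt_def GamImp_def)
  then show ?thesis
    unfolding lhs_defect_def
    by (meson card_mono finite_subformulas card_subformulas le_trans)
qed

text \<open>Encodes as one number the lexicographic order of defect, kind (irregular below regular)
  and size of the right formula. For sequents of the calculus the two lower components add up to at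
  least 1 and at most \<open>2 * fsize G\<close>, which fixes the weight of the defect.\<close>

definition rank :: "form \<Rightarrow> sequent \<Rightarrow> nat" where
  "rank G \<sigma> = lhs_defect G \<sigma> * (2 * fsize G) + (if regular \<sigma> then fsize G else 0) + fsize (rhs \<sigma>)"

lemma fsize_rhs_le: "frj_sequent G \<sigma> \<Longrightarrow> fsize (rhs \<sigma>) \<le> fsize G"
  using Sl_Sr_subformulas(2) by (auto simp: frj_sequent_def intro: fsize_subformula)

lemma step_frj_sequent:
  assumes "(\<tau>, \<sigma>) \<in> step G"
  shows "frj_sequent G \<tau>" "frj_sequent G \<sigma>"
  using assms by (auto simp: step_def frj_rule_def)

lemma step_rank:
  assumes "(\<tau>, \<sigma>) \<in> step G"
  shows "rank G \<tau> < rank G \<sigma>"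
proof (cases "lhs_defect G \<tau> < lhs_defect G \<sigma>")
  case True
  \<comment> \<open>One unit of defect covers the lower components of \<tau>; strictness comes from
    the positive size of \<open>rhs \<sigma>\<close>.\<close>
  then have "Suc (lhs_defect G \<tau>) * (2 * fsize G) \<le> lhs_defect G \<sigma> * (2 * fsize G)"
    by (intro mult_le_mono1) simp
  then show ?thesis
    using fsize_rhs_le[OF step_frj_sequent(1)[OF assms]] fsize_pos[of "rhs \<sigma>"]
    unfolding rank_def by simp
next
  case False
  \<comment> \<open>Equal closures leave two cases of \<open>step_cases\<close>: irregular to
    regular, where the bonus \<open>fsize G\<close> covers \<open>rhs \<tau>\<close>, or the same
    kind with a larger right formula.\<close>
  with step_defect[OF assms] have "lhs_defect G \<tau> = lhs_defect G \<sigma>" "Cl (lhs \<sigma>) = Cl (lhs \<tau>)"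
    by auto
  with step_cases[OF assms] fsize_rhs_le[OF step_frj_sequent(1)[OF assms]] fsize_pos[of "rhs \<sigma>"]
  show ?thesis
    unfolding rank_def by auto
qed

lemma steps_rank: "(\<tau>, \<sigma>) \<in> (step G)\<^sup>+ \<Longrightarrow> rank G \<tau> < rank G \<sigma>"
  by (induction rule: trancl_induct) (auto dest: step_rank)

lemma rank_le:
  assumes "frj_sequent G \<sigma>"
  shows "rank G \<sigma> \<le> 4 * (fsize G)\<^sup>2"
proof -
  have "rank G \<sigma> \<le> fsize G * (2 * fsize G) + fsize G + fsize G"
    unfolding rank_def
    by (intro add_mono mult_le_mono1 lhs_defect_le fsize_rhs_le assms) simp
  also have "\<dots> \<le> 4 * (fsize G)\<^sup>2"
    using le_square[of "fsize G"] unfolding power2_eq_square by linarith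
  finally show ?thesis .
qed

lemma derivation_root_frj_sequent: "frj_derivation G D \<Longrightarrow> frj_sequent G (tree_root D)"
  by (cases rule: frj_derivation.cases) (auto simp: frj_rule_def)

lemma tree_root_in_seqs: "tree_root D \<in> seqs D"
  by (cases D) auto

text \<open>Guarantees that the maximum in \<open>seq_height\<close> is never taken over the empty set.\<close>

lemma derivation_premise:
  "frj_derivation G D \<Longrightarrow> \<sigma> \<in> seqs D \<Longrightarrow> \<not> frj_axiom G \<sigma> \<Longrightarrow> \<exists>\<tau> \<in> seqs D. (\<tau>, \<sigma>) \<in> step G"
proof (induction rule: frj_derivation.induct)
  case (1 Ds \<rho>)
  show ?case
  proof (cases "\<sigma> = \<rho>")
    case True
    then have "logical_scheme G (map tree_root Ds) \<rho> \<or> join_scheme G (map tree_root Ds) \<rho>"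
      using 1 unfolding frj_rule_def frj_axiom_def by auto
    \<comment> \<open>Logical rules have one or two premises, and \<open>join_ok\<close> excludes
      the empty list.\<close>
    then have "map tree_root Ds \<noteq> []"
      by (auto elim: logical_scheme.cases join_scheme.cases simp: join_ok_def)
    then obtain D where "D \<in> set Ds" by (cases Ds) auto
    moreover from this have "(tree_root D, \<rho>) \<in> step G"
      using 1(1) by (auto simp: step_def)
    ultimately show ?thesis
      using True tree_root_in_seqs by auto
  qed (use 1 in auto)
qed

text \<open>The recursion of \<open>seq_height\<close> descends along
  \<open>(step G)\<^sup>+\<close>, where the rank drops strictly, so induction on the rank follows
  it.\<close>

lemma seq_height_le_rank:
  assumes "frj_derivation G D" "\<sigma> \<in> seqs D"
  shows "seq_height G D \<sigma> \<le> rank G \<sigma>"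
  using assms(2)
proof (induction "rank G \<sigma>" arbitrary: \<sigma> rule: less_induct)
  case less
  show ?case
  proof (cases "frj_axiom G \<sigma>")
    case True
    then show ?thesis by (simp add: seq_height.simps)
  next
    case False
    let ?B = "{\<tau> \<in> seqs D. (\<tau>, \<sigma>) \<in> (step G)\<^sup>+}"
    have "?B \<noteq> {}"
      using derivation_premise[OF assms(1) less.prems False] by blast
    moreover have "seq_height G D \<tau> < rank G \<sigma>" if "\<tau> \<in> ?B" for \<tau>
      using that less.hyps[of \<tau>] steps_rank[of \<tau> \<sigma> G] by force
    \<comment> \<open>The strict bound pays for the \<open>1 +\<close> in
      \<open>seq_height\<close>.\<close>
    ultimately have "Max (seq_height G D ` ?B) < rank G \<sigma>"
      using finite_seqs[of D] by (subst Max_less_iff) auto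
    then show ?thesis
      using False by (subst seq_height.simps) simp
  qed
qed

lemma derivation_height_le:
  assumes "frj_derivation G D"
  shows "derivation_height G D \<le> 4 * (fsize G)\<^sup>2"
  unfolding derivation_height_def
  using seq_height_le_rank[OF assms tree_root_in_seqs] rank_le[OF derivation_root_frj_sequent[OF assms]]
  by (rule le_trans)

lemma steps_defect: "(\<tau>, \<sigma>) \<in> (step G)\<^sup>* \<Longrightarrow> lhs_defect G \<tau> \<le> lhs_defect G \<sigma>"
  by (induction rule: rtrancl_induct) (auto dest: step_defect(1))

text \<open>Somewhere the chain turns from regular to irregular. By \<open>step_cases\<close> a step
  in that direction must change the closure, and the defect with it; no later step lowers the defect
  again.\<close>

lemma steps_regular_irregular:
  "(\<tau>, \<sigma>) \<in> (step G)\<^sup>* \<Longrightarrow> regular \<tau> \<Longrightarrow> \<not> regular \<sigma> \<Longrightarrow> lhs_defect G \<tau> < lhs_defect G \<sigma>"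
proof (induction rule: rtrancl_induct)
  case (step \<sigma> \<sigma>')
  show ?case
  proof (cases "regular \<sigma>")
    case True
    then have "Cl (lhs \<sigma>') \<noteq> Cl (lhs \<sigma>)"
      using step_cases[OF step(2)] step.prems by auto
    then show ?thesis
      using step_defect(2)[OF step(2)] steps_defect[OF step(1)] by simp
  next
    case False
    then show ?thesis
      using step.IH step.prems step_defect(1)[OF step(2)] by simp
  qed
qed simp

text \<open>The right formula of a p-sequent is in \<open>vars_bot\<close> or a disjunction, while a
  logical rule with regular conclusion yields a conjunction or an implication. So every instance
  with premises that concludes \<sigma> is a join.\<close>

lemma step_into_p_sequent:
  assumes "(\<tau>, \<sigma>) \<in> step G" "\<sigma> \<in> p_sequents G D"
  shows "\<not> regular \<tau>"
proof -
  obtain ps where ps: "frj_rule G ps \<sigma>" "\<tau> \<in> set ps"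
    using assms(1) by (auto simp: step_def)
  have "rhs \<sigma> \<in> vars_bot \<or> (\<exists>C1 C2. rhs \<sigma> = C1 \<sqdot>\<or> C2)" and "regular \<sigma>"
    using assms(2) unfolding p_sequents_def frj_axiom_def frj_join_def
    by (auto elim: axiom_scheme.cases join_scheme.cases)
  then have "\<not> logical_scheme G ps \<sigma>"
    by (auto elim!: logical_scheme.cases simp: vars_bot_def vars_def)
  with ps have "join_scheme G ps \<sigma>"
    by (auto simp: frj_rule_def)
  then show ?thesis
    using join_cases(2) ps(2) by blast
qed

lemma p_sequents_defect:
  assumes "(\<tau>, \<sigma>) \<in> (step G)\<^sup>*" "\<tau> \<noteq> \<sigma>" "\<tau> \<in> p_sequents G D" "\<sigma> \<in> p_sequents G D"
  shows "lhs_defect G \<tau> < lhs_defect G \<sigma>"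
proof -
  obtain \<upsilon> where \<upsilon>: "(\<tau>, \<upsilon>) \<in> (step G)\<^sup>*" "(\<upsilon>, \<sigma>) \<in> step G"
    using assms(1,2) by (meson rtranclE)
  have "lhs_defect G \<tau> < lhs_defect G \<upsilon>"
    using steps_regular_irregular[OF \<upsilon>(1)] step_into_p_sequent[OF \<upsilon>(2) assms(4)] assms(3)
    by (auto simp: p_sequents_def)
  then show ?thesis
    using step_defect(1)[OF \<upsilon>(2)] by simp
qed

text \<open>This covers sequents that are not worlds: \<open>leq\<close> relates only p-sequents, so
  \<open>greater\<close> is empty there and the height is 0.\<close>

lemma world_height_le_defect:
  assumes "frj_derivation_of_goal G D"
  shows "world_height (Mod G D) \<sigma> \<le> lhs_defect G \<sigma>"
proof (induction "lhs_defect G \<sigma>" arbitrary: \<sigma> rule: less_induct)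
  case less
  let ?U = "greater (Mod G D) \<sigma>"
  note K = kripke_model_Mod[OF assms]
  show ?case
  proof (cases "?U = {}")
    case True
    then show ?thesis using K by (subst world_height.simps) simp
  next
    case False
    have "world_height (Mod G D) \<tau> < lhs_defect G \<sigma>" if "\<tau> \<in> ?U" for \<tau>
    proof -
      have "lhs_defect G \<tau> < lhs_defect G \<sigma>"
        \<comment> \<open>The order of \<open>Mod\<close> reverses derivability: a greater world
          \<tau> is one from which \<sigma> is reached by steps.\<close>
        using that p_sequents_defect[of \<tau> \<sigma> G D] by (auto simp: greater_def Mod_def Let_def)
      then show ?thesis using less.hyps[of \<tau>] by simp
    qed
    moreover have "finite ?U"
      using K by (simp add: kripke_model_def greater_def)
    ultimately have "Max (world_height (Mod G D) ` ?U) < lhs_defect G \<sigma>"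
      using False by (subst Max_less_iff) auto
    then show ?thesis
      using K False by (subst world_height.simps) simp
  qed
qed

theorem theorem3p14:
  shows "(\<exists>f :: nat \<Rightarrow> real. f \<in> O(\<lambda>N. (real N)\<^sup>2) \<and>
            (\<forall>G D. frj_derivation G D \<longrightarrow> real (derivation_height G D) \<le> f (fsize G)))
       \<and> (\<forall>G D. frj_derivation_of_goal G D \<longrightarrow> model_height (Mod G D) \<le> fsize G)"
proof (intro conjI exI[of _ "\<lambda>N. 4 * (real N)\<^sup>2"] allI impI)
  show "(\<lambda>N. 4 * (real N)\<^sup>2) \<in> O(\<lambda>N. (real N)\<^sup>2)" by simp
next
  fix G D assume "frj_derivation G D"
  from derivation_height_le[OF this]
  have "real (derivation_height G D) \<le> real (4 * (fsize G)\<^sup>2)"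
    by (rule of_nat_mono)
  then show "real (derivation_height G D) \<le> 4 * (real (fsize G))\<^sup>2" by simp
next
  fix G D assume "frj_derivation_of_goal G D"
  from world_height_le_defect[OF this] show "model_height (Mod G D) \<le> fsize G"
    unfolding model_height_def using lhs_defect_le le_trans by blast
qed

end
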